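(* Let $p\ge5$ be an odd prime and put $$g_p:=\left\lfloor \frac{p-1}{4}\right\rfloor.$$ The set of nonzero quadratic residues $$\mathcal{Q}_p=\{x^2 \bmod p : x\not\equiv 0\pmod p\}$$ forms a modular $g_p$-Golomb ruler modulo $p$, with $(p-1)/2$ marks.
   Context: A set $\mathcal{A}$ of residues modulo $N$ is a modular $g$-Golomb ruler modulo $N$ if every nonzero residue modulo $N$ occurs at most $g$ times as a difference $a-a' \pmod N$ with $(a,a')$ an ordered pair of distinct elements of $\mathcal{A}$; its elements are called marks. *)

theory Defs
  imports Complex_Main "HOL-Number_Theory.Number_Theory"
begin

text \<open>
  Residues modulo \<open>N\<close> are represented by the integers in \<open>{0..<N}\<close>. Such sets are
  finite, so the cardinality below is a true count of ordered pairs of distinct marks.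
\<close>

definition modular_golomb_ruler :: "nat \<Rightarrow> int \<Rightarrow> int set \<Rightarrow> bool" where
  "modular_golomb_ruler g N A \<longleftrightarrow>
     0 < N \<and> A \<subseteq> {0..<N} \<and>
     (\<forall>d\<in>{1..<N}. card {(a, a'). a \<in> A \<and> a' \<in> A \<and> a \<noteq> a' \<and> (a - a') mod N = d} \<le> g)"

definition nonzero_quadratic_residues :: "int \<Rightarrow> int set" where
  "nonzero_quadratic_residues p = {x\<^sup>2 mod p | x. \<not> [x = 0] (mod p)}"

end

theory Submission
  imports Defs
begin

text \<open>
  Writing \<open>a = x\<^sup>2\<close>, \<open>a' = y\<^sup>2\<close>, a representation \<open>a - a' = d\<close> becomes a factorisation
  \<open>(x - y) * (x + y) = d\<close>, which is determined by the nonzero residue \<open>x - y\<close>. Each pair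
  \<open>(a, a')\<close> yields four sign choices \<open>(\<plusminus>x, \<plusminus>y)\<close> and hence four distinct values of
  \<open>x - y\<close>, so four times the number of representations is at most \<open>p - 1\<close>.
\<close>

lemma int_prime_not_dvd_2:
  fixes p :: int
  assumes "prime p" "odd p"
  shows "\<not> p dvd 2"
  using assms prime_ge_2_int[of p] zdvd_imp_le[of p 2] by (cases "p = 2") auto

lemma mod_in_nonzero_range:
  fixes p x :: int
  assumes "0 < p" "\<not> p dvd x"
  shows "x mod p \<in> {1..<p}"
proof -
  have "0 \<le> x mod p" "x mod p < p" "x mod p \<noteq> 0"
    using assms by (simp_all add: dvd_eq_mod_eq_0)
  then show ?thesis unfolding atLeastLessThan_iff by linarith
qed

text \<open>The square roots of a nonzero residue form a pair \<open>y\<close>,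
  \<open>p - y\<close>, and for odd \<open>p\<close> exactly one of the two lies in the lower half
  \<open>{1..(p - 1) div 2}\<close>. This yields the number of marks.\<close>

lemma nonzero_quadratic_residues_bij:
  fixes p :: int
  assumes p: "prime p" "odd p"
  shows "bij_betw (\<lambda>x. x\<^sup>2 mod p) {1..(p - 1) div 2} (nonzero_quadratic_residues p)"
  unfolding bij_betw_def
proof
  have p1: "p > 1" using p prime_gt_1_int by blast
  show "inj_on (\<lambda>x. x\<^sup>2 mod p) {1..(p - 1) div 2}"
  proof (rule inj_onI)
    fix x y assume x: "x \<in> {1..(p - 1) div 2}" and y: "y \<in> {1..(p - 1) div 2}"
      and eq: "x\<^sup>2 mod p = y\<^sup>2 mod p"
    have "p dvd (x - y) * (x + y)"
      using eq by (simp add: mod_eq_dvd_iff power2_eq_square algebra_simps)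
    then consider "p dvd x - y" | "p dvd x + y"
      using p(1) prime_dvd_mult_iff by blast
    then show "x = y"
    proof cases
      case 1
      then have "x mod p = y mod p" by (simp add: mod_eq_dvd_iff)
      moreover have "x < p" "y < p" using x y p1 by auto
      ultimately show ?thesis using x y by simp
    next
      case 2
      moreover have "0 < x + y" "x + y < p" using x y by auto
      ultimately show ?thesis using zdvd_not_zless by blast
    qed
  qed
  show "(\<lambda>x. x\<^sup>2 mod p) ` {1..(p - 1) div 2} = nonzero_quadratic_residues p" (is "?L = ?R")
  proof
    show "?L \<subseteq> ?R"
    proof
      fix a assume "a \<in> ?L"
      then obtain x where x: "x \<in> {1..(p - 1) div 2}" "a = x\<^sup>2 mod p" by auto
      then have "0 < x" "x < p" using p1 by auto
      then have "\<not> [x = 0] (mod p)" using zdvd_not_zless by (simp add: cong_0_iff)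
      with x show "a \<in> ?R" unfolding nonzero_quadratic_residues_def by blast
    qed
    show "?R \<subseteq> ?L"
    proof
      fix a assume "a \<in> ?R"
      then obtain x where x: "a = x\<^sup>2 mod p" "\<not> p dvd x"
        by (auto simp: nonzero_quadratic_residues_def cong_0_iff)
      define y where "y = x mod p"
      have y: "0 < y" "y < p" "y\<^sup>2 mod p = a"
        using mod_in_nonzero_range[OF _ x(2)] x(1) p1 by (simp_all add: y_def power_mod)
      \<comment> \<open>Both instances of \<open>power_mod\<close> reduce to the same base, since
        \<open>p - y\<close> and \<open>- y\<close> agree modulo \<open>p\<close>.\<close>
      have neg: "(p - y)\<^sup>2 mod p = a"
        using y(3) power_mod[of "p - y" p 2] power_mod[of "- y" p 2] by simp
      show "a \<in> ?L"
      proof (cases "y \<le> (p - 1) div 2")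
        case True
        then show ?thesis using y by force
      next
        case False
        then have "p - y \<in> {1..(p - 1) div 2}" using y p(2) by (auto elim!: oddE)
        then show ?thesis using neg by force
      qed
    qed
  qed
qed

lemma card_nonzero_quadratic_residues:
  fixes p :: int
  assumes "prime p" "odd p"
  shows "card (nonzero_quadratic_residues p) = nat ((p - 1) div 2)"
  using bij_betw_same_card[OF nonzero_quadratic_residues_bij[OF assms]] by simp

text \<open>The set \<open>S\<close>, enlarged by two independent signs, injects into the nonzero
  residues. Keeping the factor 4 on the left postpones the floor to the final theorem.\<close>

lemma card_quadratic_residue_differences:
  fixes p d :: int
  assumes p: "prime p" "odd p" and d: "d \<in> {1..<p}"
  defines "S \<equiv> {(a, a'). a \<in> nonzero_quadratic_residues p \<and> a' \<in> nonzero_quadratic_residues p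
                 \<and> a \<noteq> a' \<and> (a - a') mod p = d}"
  shows "4 * card S \<le> nat (p - 1)"
proof -
  have p1: "p > 1" using p prime_gt_1_int by blast
  \<comment> \<open>One arbitrary root \<open>r a\<close> is fixed for each residue; the signs in
    \<open>U\<close> supply the other one.\<close>
  have "\<exists>r. \<not> p dvd r \<and> r\<^sup>2 mod p = a" if "a \<in> nonzero_quadratic_residues p" for a
    using that by (auto simp: nonzero_quadratic_residues_def cong_0_iff)
  then obtain r where r: "\<And>a. a \<in> nonzero_quadratic_residues p \<Longrightarrow> \<not> p dvd r a \<and> (r a)\<^sup>2 mod p = a"
    by metis
  have root_cong: "[(r a)\<^sup>2 = a] (mod p)" if "a \<in> nonzero_quadratic_residues p" for a
    using r[OF that] cong_mod_right[of "(r a)\<^sup>2" "(r a)\<^sup>2" p] by (simp del: cong_mod_right)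
  define U :: "int set" where "U = {1, -1}"
  have sq: "s\<^sup>2 = 1" if "s \<in> U" for s using that by (auto simp: U_def)
  have factor: "[(s * r a - t * r a') * (s * r a + t * r a') = d] (mod p)"
    if "(a, a') \<in> S" "s \<in> U" "t \<in> U" for a a' s t
  proof -
    have "(s * r a - t * r a') * (s * r a + t * r a') = s\<^sup>2 * (r a)\<^sup>2 - t\<^sup>2 * (r a')\<^sup>2"
      by (simp add: power2_eq_square algebra_simps)
    also have "\<dots> = (r a)\<^sup>2 - (r a')\<^sup>2" using sq that by simp
    also have "[\<dots> = a - a'] (mod p)"
      using that root_cong by (intro cong_diff) (auto simp: S_def)
    also have "[a - a' = d] (mod p)" using that by (auto simp: S_def cong_def)
    finally show ?thesis .
  qed
  have nd: "\<not> p dvd d" using d zdvd_not_zless[of d p] by simp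
  have cancel: "[z = z'] (mod p)" if "[k * z = k * z'] (mod p)" "\<not> p dvd k" for k z z' :: int
    using that(1) cong_mult_lcancel[of k p] prime_imp_coprime[OF p(1) that(2)]
    by (simp add: coprime_commute)
  \<comment> \<open>Squaring removes the signs and recovers the residue. Then \<open>p\<close>
    divides \<open>s - t\<close>, which is 0, 2 or -2, and an odd prime does not divide 2.\<close>
  have root_unique: "a = b \<and> s = t"
    if ab: "a \<in> nonzero_quadratic_residues p" "b \<in> nonzero_quadratic_residues p"
      and st: "s \<in> U" "t \<in> U" and eq: "[s * r a = t * r b] (mod p)" for a b s t
  proof
    have "[(s * r a)\<^sup>2 = (t * r b)\<^sup>2] (mod p)" using eq by (rule cong_pow)
    then have "(r a)\<^sup>2 mod p = (r b)\<^sup>2 mod p"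
      using sq st by (simp add: power_mult_distrib cong_def)
    then show a: "a = b" using r[OF ab(1)] r[OF ab(2)] by argo
    have "p dvd (s - t) * r b" using eq a by (simp add: cong_iff_dvd_diff algebra_simps)
    then have "p dvd s - t" using r[OF ab(2)] p(1) prime_dvd_mult_iff by blast
    then show "s = t" using st int_prime_not_dvd_2[OF p] by (auto simp: U_def)
  qed
  define f where "f = (\<lambda>((a, a'), s, t). (s * r a - t * r a') mod p)"
  have inj: "inj_on f (S \<times> U \<times> U)"
  proof (rule inj_onI)
    fix w w' assume w: "w \<in> S \<times> U \<times> U" "w' \<in> S \<times> U \<times> U" "f w = f w'"
    obtain a a' s t b b' s' t' where ww: "w = ((a, a'), s, t)" "w' = ((b, b'), s', t')"
      by (metis surj_pair)
    have S: "(a, a') \<in> S" "(b, b') \<in> S" and U: "s \<in> U" "t \<in> U" "s' \<in> U" "t' \<in> U"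
      and eq: "f ((a, a'), s, t) = f ((b, b'), s', t')"
      using w by (simp_all add: ww)
    define x y x' y' where xy: "x = s * r a" "y = t * r a'" "x' = s' * r b" "y' = t' * r b'"
    have u: "[x - y = x' - y'] (mod p)" using eq by (simp add: f_def xy cong_def)
    have prods: "[(x - y) * (x + y) = d] (mod p)" "[(x' - y') * (x' + y') = d] (mod p)"
      using factor S U by (auto simp: xy)
    \<comment> \<open>Both products are congruent to \<open>d\<close>, and \<open>u\<close> replaces
      the first factor of the second one. The common factor is invertible because it divides the
      nonzero \<open>d\<close> modulo \<open>p\<close>.\<close>
    have "[(x - y) * (x + y) = (x - y) * (x' + y')] (mod p)"
      by (rule cong_trans[OF cong_trans[OF prods(1) cong_sym[OF prods(2)]]
            cong_sym[OF cong_scalar_right[OF u]]])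
    moreover have "\<not> p dvd x - y"
      using cong_dvd_iff[OF prods(1)] nd by auto
    ultimately have v: "[x + y = x' + y'] (mod p)"
      by (rule cancel)
    \<comment> \<open>Sum and difference of the two factors recover \<open>x\<close> and
      \<open>y\<close> up to the factor 2, which is invertible as \<open>p\<close> is odd.\<close>
    have "[2 * x = 2 * x'] (mod p)" "[2 * y = 2 * y'] (mod p)"
      using cong_add[OF v u] cong_diff[OF v u] by simp_all
    then have "[x = x'] (mod p)" "[y = y'] (mod p)"
      using cancel[OF _ int_prime_not_dvd_2[OF p]] by blast+
    then show "w = w'"
      using root_unique[of a b s s'] root_unique[of a' b' t t'] S U by (simp add: ww xy S_def)
  qed
  have "f ` (S \<times> U \<times> U) \<subseteq> {1..<p}"
  proof clarify
    fix a a' s t assume S: "(a, a') \<in> S" "s \<in> U" "t \<in> U"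
    have "\<not> p dvd s * r a - t * r a'"
      using cong_dvd_iff[OF factor[OF S]] nd by auto
    then show "f ((a, a'), s, t) \<in> {1..<p}"
      using p1 mod_in_nonzero_range by (simp add: f_def)
  qed
  then have "card (S \<times> U \<times> U) \<le> card {1..<p}"
    using card_inj_on_le[OF inj] by blast
  then show ?thesis by (simp add: card_cartesian_product U_def)
qed

theorem theorem10:
  fixes p :: nat
  assumes "prime p" and "odd p" and "p \<ge> 5"
  shows "modular_golomb_ruler (nat \<lfloor>(real p - 1) / 4\<rfloor>) (int p) (nonzero_quadratic_residues (int p))
    \<and> real (card (nonzero_quadratic_residues (int p))) = (real p - 1) / 2"
proof
  have p: "prime (int p)" "odd (int p)" using assms by auto
  show "modular_golomb_ruler (nat \<lfloor>(real p - 1) / 4\<rfloor>) (int p) (nonzero_quadratic_residues (int p))"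
    unfolding modular_golomb_ruler_def
  proof (intro conjI ballI)
    show "0 < int p" using assms by simp
    then show "nonzero_quadratic_residues (int p) \<subseteq> {0..<int p}"
      by (auto simp: nonzero_quadratic_residues_def)
    fix d assume "d \<in> {1..<int p}"
    from card_quadratic_residue_differences[OF p this]
    show "card {(a, a'). a \<in> nonzero_quadratic_residues (int p) \<and> a' \<in> nonzero_quadratic_residues (int p)
        \<and> a \<noteq> a' \<and> (a - a') mod int p = d} \<le> nat \<lfloor>(real p - 1) / 4\<rfloor>"
      \<comment> \<open>The cardinality is a natural number at most \<open>(real p - 1) / 4\<close>,
        hence at most the floor.\<close>
      using assms(3) by (simp add: le_nat_floor)
  qed
  show "real (card (nonzero_quadratic_residues (int p))) = (real p - 1) / 2"
    \<comment> \<open>Oddness of \<open>p\<close> makes the integer division by 2 exact.\<close>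
    using card_nonzero_quadratic_residues[OF p] assms(2,3) by (auto elim!: oddE)
qed

end
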